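(* Let $X$ be a regular topological space. If Two has a winning strategy in the Menger game on $X$, then $X$ is an Alster space.
   Context: The Menger game on a topological space $X$ is played by One and Two as follows: in each inning $n\in\omega$, One chooses an open cover $\mathcal U_n$ of $X$, and then Two chooses a finite subset $\mathcal F_n$ of $\mathcal U_n$. Two wins the play if $\bigcup_{n\in\omega}\mathcal F_n$ is a cover of $X$; otherwise One wins. A winning strategy for Two is a function assigning to each finite nonempty sequence $(\mathcal U_0,\dots,\mathcal U_n)$ of moves of One a legal answer $\mathcal F_n$ of Two such that Two wins every play in which her moves are given by this function. An Alster cover of $X$ is a cover $\mathcal W$ of $X$ by $G_\delta$ subsets of $X$ such that every compact subset of $X$ is included in some element of $\mathcal W$. The space $X$ is an Alster space if every Alster cover of $X$ has a countable subset that covers $X$. *)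

theory Defs
  imports "HOL-Analysis.Analysis"
begin

definition cover_of :: "'a topology \<Rightarrow> 'a set set \<Rightarrow> bool" where
  "cover_of X \<U> \<longleftrightarrow> \<Union>\<U> = topspace X"

definition open_cover_of :: "'a topology \<Rightarrow> 'a set set \<Rightarrow> bool" where
  "open_cover_of X \<U> \<longleftrightarrow> (\<forall>U\<in>\<U>. openin X U) \<and> cover_of X \<U>"

text \<open>
  In inning \<open>n\<close>, player One plays \<open>\<U> n\<close> and player Two answers with \<open>\<F> n\<close>.
\<close>

definition Menger_play ::
    "'a topology \<Rightarrow> (nat \<Rightarrow> 'a set set) \<Rightarrow> (nat \<Rightarrow> 'a set set) \<Rightarrow> bool" where
  "Menger_play X \<U> \<F> \<longleftrightarrow>
     (\<forall>n. open_cover_of X (\<U> n) \<and> finite (\<F> n) \<and> \<F> n \<subseteq> \<U> n)"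

definition Two_wins_Menger_play :: "'a topology \<Rightarrow> (nat \<Rightarrow> 'a set set) \<Rightarrow> bool" where
  "Two_wins_Menger_play X \<F> \<longleftrightarrow> cover_of X (\<Union>n. \<F> n)"

text \<open>
  A strategy for Two maps the list \<open>[\<U>\<^sub>0, \<dots>, \<U>\<^sub>n]\<close> of the moves of One so far, in
  chronological order, to the answer of Two in inning \<open>n\<close>. Its values on the empty list and
  on lists that do not consist of open covers are irrelevant.
\<close>

type_synonym 'a Menger_strategy = "'a set set list \<Rightarrow> 'a set set"

definition Two_Menger_strategy :: "'a topology \<Rightarrow> 'a Menger_strategy \<Rightarrow> bool" where
  "Two_Menger_strategy X \<sigma> \<longleftrightarrow>
     (\<forall>s. s \<noteq> [] \<and> (\<forall>\<U>\<in>set s. open_cover_of X \<U>) \<longrightarrow> finite (\<sigma> s) \<and> \<sigma> s \<subseteq> last s)"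

definition Two_Menger_winning_strategy :: "'a topology \<Rightarrow> 'a Menger_strategy \<Rightarrow> bool" where
  "Two_Menger_winning_strategy X \<sigma> \<longleftrightarrow>
     Two_Menger_strategy X \<sigma> \<and>
     (\<forall>\<U> \<F>. Menger_play X \<U> \<F> \<and> (\<forall>n. \<F> n = \<sigma> (map \<U> [0..<Suc n]))
             \<longrightarrow> Two_wins_Menger_play X \<F>)"

definition Alster_cover :: "'a topology \<Rightarrow> 'a set set \<Rightarrow> bool" where
  "Alster_cover X \<W> \<longleftrightarrow>
     cover_of X \<W> \<and> (\<forall>W\<in>\<W>. gdelta_in X W) \<and>
     (\<forall>K. compactin X K \<longrightarrow> (\<exists>W\<in>\<W>. K \<subseteq> W))"

definition Alster_space :: "'a topology \<Rightarrow> bool" where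
  "Alster_space X \<longleftrightarrow>
     (\<forall>\<W>. Alster_cover X \<W> \<longrightarrow> (\<exists>\<V>\<subseteq>\<W>. countable \<V> \<and> cover_of X \<V>))"

end

theory Submission
  imports Defs
begin

text \<open>
  Fix a winning strategy \<open>\<sigma>\<close> of Two. At a position \<open>s\<close>, let \<open>K\<^sub>s\<close> be the set of points that lie in
  the closure of \<open>\<Union>(\<sigma> (s @ [\<U>]))\<close> for every open cover \<open>\<U>\<close>, that is, the points that Two all but
  covers whatever One plays next. Regularity makes \<open>K\<^sub>s\<close> compact
  (\<open>compactin_Inter_closure_of_answers\<close>): One may play a cover whose members have closures
  inside members of a prescribed open cover, and Two's finite answer then yields a finite
  subcover of \<open>K\<^sub>s\<close>.

  An Alster cover \<open>\<W>\<close> therefore has a member \<open>W\<^sub>s\<close> that includes \<open>K\<^sub>s\<close>. The strategy also makes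
  \<open>X\<close> Lindelof (\<open>Menger_winning_strategy_imp_Lindelof\<close>). Since \<open>W\<^sub>s\<close> is a \<open>G\<^sub>\<delta>\<close>,
  countably many moves of One already force the intersection down into \<open>W\<^sub>s\<close>
  (\<open>Lindelof_Inter_subset_gdelta\<close>). When One uses only these moves, just countably many
  positions can arise, and the sets \<open>W\<^sub>s\<close> at these positions cover \<open>X\<close>: if \<open>x\<close> were in none of
  them, then at every position One could choose one of these moves that makes Two's answer
  miss \<open>x\<close>, and One would win the resulting play.
\<close>

text \<open>
  Let \<open>C\<close> be the intersection. An open family that covers \<open>C\<close>, completed by the complement of
  \<open>C\<close>, is refined by an open cover, even with respect to closures, and the reply of Two to that
  refinement is finite. The function \<open>F\<close> is Two's reply in a single inning, with the earlier innings fixed.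
\<close>

lemma compactin_Inter_closure_of_answers:
  assumes reg: "regular_space X"
    and answer: "\<And>\<U>. open_cover_of X \<U> \<Longrightarrow> finite (F \<U>) \<and> F \<U> \<subseteq> \<U>"
  shows "compactin X (topspace X \<inter> (\<Inter>\<U>\<in>{\<U>. open_cover_of X \<U>}. X closure_of \<Union>(F \<U>)))"
proof -
  define C where "C = topspace X \<inter> (\<Inter>\<U>\<in>{\<U>. open_cover_of X \<U>}. X closure_of \<Union>(F \<U>))"
  have C_topspace: "C \<subseteq> topspace X" by (simp add: C_def)
  have C_closure: "C \<subseteq> X closure_of \<Union>(F \<U>)" if "open_cover_of X \<U>" for \<U>
    using that unfolding C_def by blast
  have "open_cover_of X {topspace X}" by (simp add: open_cover_of_def cover_of_def)
  then have "closedin X C"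
    unfolding C_def
    by (intro closedin_Int closedin_INT closedin_topspace closedin_closure_of) blast
  then have open_compl: "openin X (topspace X - C)" by blast
  have "\<exists>\<F>. finite \<F> \<and> \<F> \<subseteq> \<O> \<and> C \<subseteq> \<Union>\<F>"
    if \<O>: "\<And>G. G \<in> \<O> \<Longrightarrow> openin X G" "C \<subseteq> \<Union>\<O>" for \<O>
  proof -
    define \<U> where
      "\<U> = {U. openin X U \<and> (\<exists>G\<in>insert (topspace X - C) \<O>. X closure_of U \<subseteq> G)}"
    have "\<exists>U\<in>\<U>. x \<in> U" if x: "x \<in> topspace X" for x
    proof -
      obtain G where G: "G \<in> insert (topspace X - C) \<O>" "x \<in> G"
        using x \<O>(2) by blast
      then have "openin X G" using \<O>(1) open_compl by blast
      then have "closedin X (topspace X - G)" by blast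
      moreover have "x \<in> topspace X - (topspace X - G)" using x G(2) by simp
      ultimately obtain U where U: "openin X U" "x \<in> U" "disjnt (topspace X - G) (X closure_of U)"
        using reg unfolding regular_space by metis
      then have "X closure_of U \<subseteq> G"
        using closure_of_subset_topspace[of X U] unfolding disjnt_iff by blast
      with G(1) U(1) have "U \<in> \<U>" unfolding \<U>_def by blast
      then show ?thesis using U(2) by (rule bexI[rotated])
    qed
    then have \<U>: "open_cover_of X \<U>"
      unfolding open_cover_of_def cover_of_def by (auto simp: \<U>_def dest: openin_subset)
    then have fin: "finite (F \<U>)" and sub: "F \<U> \<subseteq> \<U>" using answer by auto
    have "\<exists>G. G \<in> insert (topspace X - C) \<O> \<and> X closure_of U \<subseteq> G" if "U \<in> F \<U>" for U
    proof -
      have "U \<in> \<U>" using sub that by (rule subsetD)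
      then show ?thesis unfolding \<U>_def by blast
    qed
    then obtain g where g:
      "\<And>U. U \<in> F \<U> \<Longrightarrow> g U \<in> insert (topspace X - C) \<O> \<and> X closure_of U \<subseteq> g U"
      by metis
    have "C \<subseteq> X closure_of \<Union>(F \<U>)" using \<U> by (rule C_closure)
    then have "C \<subseteq> (\<Union>U\<in>F \<U>. g U)"
      unfolding closure_of_Union[OF fin] using g by blast
    then have "C \<subseteq> \<Union>(g ` F \<U> \<inter> \<O>)" using g by blast
    then show ?thesis
      using fin by (intro exI[of _ "g ` F \<U> \<inter> \<O>"]) auto
  qed
  then have "compactin X C" using C_topspace by (simp add: compactin_def)
  then show ?thesis by (simp only: C_def)
qed

text \<open>
  The complement of an open set \<open>G\<close> is Lindelof, so countably many members of \<open>\<K>\<close> suffice to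
  bring the intersection inside \<open>G\<close>; a \<open>G\<^sub>\<delta>\<close> set is handled by countably many \<open>G\<close>.
\<close>

lemma Lindelof_Inter_subset_gdelta:
  assumes X: "Lindelof_space X" and closed: "\<And>K. K \<in> \<K> \<Longrightarrow> closedin X K"
    and W: "gdelta_in X W" and sub: "topspace X \<inter> \<Inter>\<K> \<subseteq> W"
  obtains \<L> where "countable \<L>" "\<L> \<subseteq> \<K>" "topspace X \<inter> \<Inter>\<L> \<subseteq> W"
proof -
  obtain \<G> where \<G>: "countable \<G>" "\<And>G. G \<in> \<G> \<Longrightarrow> openin X G" "\<Inter>\<G> = W"
    using W by (auto simp: gdelta_in_alt intersection_of_def)
  have "\<exists>\<L>. countable \<L> \<and> \<L> \<subseteq> \<K> \<and> topspace X \<inter> \<Inter>\<L> \<subseteq> G" if "G \<in> \<G>" for G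
  proof -
    let ?\<U> = "insert G ((\<lambda>K. topspace X - K) ` \<K>)"
    have G: "openin X G" "W \<subseteq> G" using that \<G> by auto
    have "topspace X - G \<subseteq> (\<Union>K\<in>\<K>. topspace X - K)" using sub G(2) by auto
    then have cover: "\<Union>?\<U> = topspace X"
      using openin_subset[OF G(1)] by auto
    have "\<exists>\<V>. countable \<V> \<and> \<V> \<subseteq> ?\<U> \<and> \<Union>\<V> = topspace X"
    proof (rule Lindelof_spaceD[OF X _ cover])
      show "openin X U" if "U \<in> ?\<U>" for U
        using that G(1) closed by (elim insertE imageE) (simp_all add: openin_diff)
    qed
    then obtain \<V> where \<V>: "countable \<V>" "\<V> \<subseteq> ?\<U>" "\<Union>\<V> = topspace X"
      by (elim exE conjE)
    have "countable (\<V> - {G})" using \<V>(1) by simp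
    moreover have "\<V> - {G} \<subseteq> (\<lambda>K. topspace X - K) ` \<K>"
      using \<V>(2) unfolding Diff_subset_conv by simp
    ultimately obtain \<L> where \<L>: "countable \<L>" "\<L> \<subseteq> \<K>" "\<V> - {G} = (\<lambda>K. topspace X - K) ` \<L>"
      by (metis countable_subset_image)
    have "topspace X \<inter> \<Inter>\<L> \<subseteq> G"
    proof
      fix x assume x: "x \<in> topspace X \<inter> \<Inter>\<L>"
      then obtain V where V: "V \<in> \<V>" "x \<in> V" using \<V>(3) by blast
      have "V \<notin> (\<lambda>K. topspace X - K) ` \<L>" using x V(2) by blast
      then have "V = G" using V(1) \<L>(3) by blast
      then show "x \<in> G" using V(2) by simp
    qed
    then show ?thesis using \<L>(1,2) by blast
  qed
  then obtain L where L:
    "\<And>G. G \<in> \<G> \<Longrightarrow> countable (L G) \<and> L G \<subseteq> \<K> \<and> topspace X \<inter> \<Inter>(L G) \<subseteq> G"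
    by metis
  have "countable (\<Union>G\<in>\<G>. L G)" "(\<Union>G\<in>\<G>. L G) \<subseteq> \<K>" using L \<G>(1) by auto
  moreover have "topspace X \<inter> \<Inter>(\<Union>G\<in>\<G>. L G) \<subseteq> W"
    unfolding \<G>(3)[symmetric]
  proof (intro subsetI InterI)
    fix x G assume x: "x \<in> topspace X \<inter> \<Inter>(\<Union>G\<in>\<G>. L G)" and G: "G \<in> \<G>"
    then have "x \<in> topspace X \<inter> \<Inter>(L G)" by auto
    with L[OF G] show "x \<in> G" by (meson subsetD)
  qed
  ultimately show thesis by (rule that)
qed

text \<open>
  Let player One play the same cover in every inning: Two's finite answers together form a
  countable subcover.
\<close>

lemma Menger_winning_strategy_imp_Lindelof:
  assumes "Two_Menger_winning_strategy X \<sigma>"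
  shows "Lindelof_space X"
  unfolding Lindelof_space_def
proof (intro allI impI)
  fix \<U> assume "(\<forall>U\<in>\<U>. openin X U) \<and> \<Union>\<U> = topspace X"
  then have \<U>: "open_cover_of X \<U>" by (simp add: open_cover_of_def cover_of_def)
  define \<F> where "\<F> n = \<sigma> (map (\<lambda>_. \<U>) [0..<Suc n])" for n
  have answer: "finite (\<F> n) \<and> \<F> n \<subseteq> \<U>" for n
    using assms \<U> unfolding Two_Menger_winning_strategy_def Two_Menger_strategy_def \<F>_def
    by (auto dest!: spec[of _ "map (\<lambda>_. \<U>) [0..<Suc n]"])
  then have "Menger_play X (\<lambda>_. \<U>) \<F>" using \<U> by (simp add: Menger_play_def)
  then have "cover_of X (\<Union>n. \<F> n)"
    using assms unfolding Two_Menger_winning_strategy_def Two_wins_Menger_play_def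
    by (metis \<F>_def)
  then show "\<exists>\<V>. countable \<V> \<and> \<V> \<subseteq> \<U> \<and> \<Union>\<V> = topspace X"
    using answer unfolding cover_of_def
    by (intro exI[of _ "\<Union>n. \<F> n"]) (auto intro!: countable_UN intro: countable_finite)
qed

text \<open>
  The bridge from one inning to the whole game: closures served the compactness argument, but
  the play only records membership in \<open>\<Union>(F \<U>)\<close> itself. A point outside \<open>W\<close> is missed by Two's
  reply to one of the countably many moves \<open>u n\<close>.
\<close>

lemma Menger_strategy_one_step:
  assumes reg: "regular_space X" and Lin: "Lindelof_space X" and \<W>: "Alster_cover X \<W>"
    and answer: "\<And>\<U>. open_cover_of X \<U> \<Longrightarrow> finite (F \<U>) \<and> F \<U> \<subseteq> \<U>"
  obtains W u where "W \<in> \<W>" "\<And>n::nat. open_cover_of X (u n)"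
    "topspace X \<inter> (\<Inter>n. \<Union>(F (u n))) \<subseteq> W"
proof -
  let ?\<C> = "{\<U>. open_cover_of X \<U>}" and ?cl = "\<lambda>\<U>. X closure_of \<Union>(F \<U>)"
  have "compactin X (topspace X \<inter> \<Inter>(?cl ` ?\<C>))"
    using reg answer by (rule compactin_Inter_closure_of_answers)
  then obtain W where W: "W \<in> \<W>" "topspace X \<inter> \<Inter>(?cl ` ?\<C>) \<subseteq> W"
    using \<W> unfolding Alster_cover_def by metis
  have "gdelta_in X W" using \<W> W(1) by (simp add: Alster_cover_def)
  moreover have "\<And>K. K \<in> ?cl ` ?\<C> \<Longrightarrow> closedin X K" by auto
  ultimately obtain \<L> where \<L>: "countable \<L>" "\<L> \<subseteq> ?cl ` ?\<C>" "topspace X \<inter> \<Inter>\<L> \<subseteq> W"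
    using Lindelof_Inter_subset_gdelta[OF Lin _ _ W(2)] by blast
  then obtain \<D> where \<D>: "countable \<D>" "\<D> \<subseteq> ?\<C>" "\<L> = ?cl ` \<D>"
    by (meson countable_subset_image)
  \<comment> \<open>The trivial cover is added because only a nonempty set has an enumeration.\<close>
  define u where "u = from_nat_into (insert {topspace X} \<D>)"
  have range: "range u = insert {topspace X} \<D>"
    unfolding u_def using \<D>(1) by (intro range_from_nat_into) auto
  have "{topspace X} \<in> ?\<C>" by (simp add: open_cover_of_def cover_of_def)
  then have "range u \<subseteq> ?\<C>" using \<D>(2) unfolding range by simp
  then have u: "open_cover_of X (u n)" for n by blast
  have answer_closure: "\<Union>(F (u n)) \<subseteq> ?cl (u n)" for n
    using answer[OF u] u[of n] unfolding open_cover_of_def cover_of_def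
    by (intro closure_of_subset) blast
  have "x \<in> K" if x: "x \<in> (\<Inter>n. \<Union>(F (u n)))" and "K \<in> \<L>" for x K
  proof -
    obtain \<U> where \<U>: "\<U> \<in> \<D>" "K = ?cl \<U>" using \<open>K \<in> \<L>\<close> unfolding \<D>(3) by (rule imageE)
    have "\<U> \<in> range u" using \<U>(1) range by simp
    then obtain n where "\<U> = u n" by (rule rangeE)
    moreover have "x \<in> \<Union>(F (u n))" using x by (rule INT_D) simp
    ultimately show ?thesis using answer_closure[of n] \<U>(2) by auto
  qed
  then have "(\<Inter>n. \<Union>(F (u n))) \<subseteq> \<Inter>\<L>" by (intro subsetI InterI)
  then have "topspace X \<inter> (\<Inter>n. \<Union>(F (u n))) \<subseteq> W"
    using \<L>(3) by (meson Int_mono order_refl order_trans)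
  with W(1) u show thesis by (rule that)
qed

text \<open>
  Here \<open>u s k\<close> is the \<open>k\<close>-th of the moves that One considers at position \<open>s\<close>; the indices chosen
  so far are listed with the latest first, so that the recursion can follow the list.
\<close>

primrec position :: "('b list \<Rightarrow> nat \<Rightarrow> 'b) \<Rightarrow> nat list \<Rightarrow> 'b list" where
  "position u [] = []"
| "position u (k # ks) = position u ks @ [u (position u ks) k]"

lemma set_position_subset:
  assumes "\<And>s k. set s \<subseteq> A \<Longrightarrow> u s k \<in> A"
  shows "set (position u ks) \<subseteq> A"
proof (induction ks)
  case (Cons k ks)
  then show ?case using assms[OF Cons.IH] by simp
qed simp

theorem corollary2p13:
  fixes X :: "'a topology"
  assumes "regular_space X"
    and "\<exists>\<sigma>. Two_Menger_winning_strategy X \<sigma>"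
  shows "Alster_space X"
  unfolding Alster_space_def
proof (intro allI impI)
  fix \<W> assume \<W>: "Alster_cover X \<W>"
  obtain \<sigma> where \<sigma>: "Two_Menger_winning_strategy X \<sigma>" using assms(2) by blast
  let ?\<C> = "{\<U>. open_cover_of X \<U>}"
  have answer: "finite (\<sigma> (s @ [\<U>])) \<and> \<sigma> (s @ [\<U>]) \<subseteq> \<U>"
    if "set s \<subseteq> ?\<C>" "open_cover_of X \<U>" for s \<U>
  proof -
    have "s @ [\<U>] \<noteq> [] \<and> (\<forall>\<V>\<in>set (s @ [\<U>]). open_cover_of X \<V>)" using that by auto
    with \<sigma> have "finite (\<sigma> (s @ [\<U>])) \<and> \<sigma> (s @ [\<U>]) \<subseteq> last (s @ [\<U>])"
      unfolding Two_Menger_winning_strategy_def Two_Menger_strategy_def by metis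
    then show ?thesis by simp
  qed
  have "\<exists>W u. W \<in> \<W> \<and> (\<forall>n::nat. open_cover_of X (u n)) \<and>
          topspace X \<inter> (\<Inter>n. \<Union>(\<sigma> (s @ [u n]))) \<subseteq> W" if "set s \<subseteq> ?\<C>" for s
  proof (rule Menger_strategy_one_step[where F = "\<lambda>\<U>. \<sigma> (s @ [\<U>])"])
    show "regular_space X" "Lindelof_space X" "Alster_cover X \<W>"
      using assms(1) Menger_winning_strategy_imp_Lindelof[OF \<sigma>] \<W> by auto
    show "finite (\<sigma> (s @ [\<U>])) \<and> \<sigma> (s @ [\<U>]) \<subseteq> \<U>" if "open_cover_of X \<U>" for \<U>
      using \<open>set s \<subseteq> ?\<C>\<close> that by (rule answer)
  qed (intro exI conjI allI)
  then obtain W u where W: "\<And>s. set s \<subseteq> ?\<C> \<Longrightarrow> W s \<in> \<W>"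
    and u: "\<And>s n. set s \<subseteq> ?\<C> \<Longrightarrow> open_cover_of X (u s n)"
    and meet: "\<And>s. set s \<subseteq> ?\<C> \<Longrightarrow> topspace X \<inter> (\<Inter>n::nat. \<Union>(\<sigma> (s @ [u s n]))) \<subseteq> W s"
    by metis
  have legal: "set (position u ks) \<subseteq> ?\<C>" for ks
    using u by (intro set_position_subset) auto
  let ?\<V> = "range (\<lambda>ks. W (position u ks))"
  have "x \<in> \<Union>?\<V>" if x: "x \<in> topspace X" for x
  proof (rule ccontr)
    assume "x \<notin> \<Union>?\<V>"
    then have "\<exists>k. x \<notin> \<Union>(\<sigma> (position u (k # ks)))" for ks
      using x meet[OF legal[of ks]] by auto
    then obtain k where k: "\<And>ks. x \<notin> \<Union>(\<sigma> (position u (k ks # ks)))" by metis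
    \<comment> \<open>\<open>r n\<close> lists the indices that One, always avoiding \<open>x\<close>, has chosen before inning \<open>n\<close>.\<close>
    define r where "r = rec_nat [] (\<lambda>_ ks. k ks # ks)"
    have r: "r 0 = []" "r (Suc n) = k (r n) # r n" for n by (simp_all add: r_def)
    define \<U> where "\<U> n = u (position u (r n)) (k (r n))" for n
    have play: "position u (r n) = map \<U> [0..<n]" for n
      by (induction n) (simp_all add: r \<U>_def)
    have \<U>: "open_cover_of X (\<U> n)" for n unfolding \<U>_def using u legal by blast
    have "Menger_play X \<U> (\<lambda>n. \<sigma> (map \<U> [0..<Suc n]))"
      unfolding Menger_play_def
    proof (intro allI conjI)
      fix n
      show "open_cover_of X (\<U> n)" by (rule \<U>)
      have "finite (\<sigma> (map \<U> [0..<n] @ [\<U> n])) \<and> \<sigma> (map \<U> [0..<n] @ [\<U> n]) \<subseteq> \<U> n"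
        using \<U> by (intro answer) auto
      then show "finite (\<sigma> (map \<U> [0..<Suc n]))" "\<sigma> (map \<U> [0..<Suc n]) \<subseteq> \<U> n" by simp_all
    qed
    then have "cover_of X (\<Union>n. \<sigma> (map \<U> [0..<Suc n]))"
      using \<sigma> unfolding Two_Menger_winning_strategy_def Two_wins_Menger_play_def by blast
    then obtain n where "x \<in> \<Union>(\<sigma> (map \<U> [0..<Suc n]))"
      using x unfolding cover_of_def by blast
    moreover have "x \<notin> \<Union>(\<sigma> (position u (r (Suc n))))" unfolding r by (rule k)
    ultimately show False unfolding play by contradiction
  qed
  moreover have "?\<V> \<subseteq> \<W>" using W legal by blast
  moreover have "\<Union>\<W> = topspace X" using \<W> by (simp add: Alster_cover_def cover_of_def)
  ultimately have "cover_of X ?\<V>" unfolding cover_of_def by blast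
  then show "\<exists>\<V>\<subseteq>\<W>. countable \<V> \<and> cover_of X \<V>"
    using \<open>?\<V> \<subseteq> \<W>\<close> by (intro exI[of _ ?\<V>]) auto
qed

end
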